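(* For every finite or infinite sequence $\mathbf f$ over $\{-1,1\}$, the only nonempty palindromes that can occur as factors of the run-length sequence $R_{\mathbf f}$ are $1, 2, 3, 22, 212, 232, 12321$, and $32123$.
   Context: For a finite sequence $\mathbf f$ over $\{-1,1\}$ define $P_\epsilon=\epsilon$ (empty) and $P_{\mathbf f a}=P_{\mathbf f}\ a\ (-P_{\mathbf f}^R)$ for $a\in\{-1,1\}$, where $-x$ negates every entry and $x^R$ is reversal. For an infinite $\mathbf f=f_0f_1\cdots$, $P_{\mathbf f}$ is the unique infinite sequence having every $P_{f_0\cdots f_n}$ as a prefix. A run is a maximal block of consecutive identical entries; the run-length sequence $R_{\mathbf f}$ is the sequence of lengths of the runs of $P_{\mathbf f}$ from left to right (a word over $\{1,2,3\}$). A factor is a contiguous block; a palindrome is a word equal to its reversal. *)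

theory Defs
  imports Main "HOL-Library.Infinite_Set" "HOL-Library.Sublist"
begin

definition paperfold :: "int list \<Rightarrow> int list" where
  "paperfold f = foldl (\<lambda>p a. p @ [a] @ map uminus (rev p)) [] f"

lemma paperfold_Nil [simp]: "paperfold [] = []"
  by (simp add: paperfold_def)

lemma paperfold_snoc [simp]:
  "paperfold (f @ [a]) = paperfold f @ [a] @ map uminus (rev (paperfold f))"
  by (simp add: paperfold_def)

definition paperfold_inf :: "(nat \<Rightarrow> int) \<Rightarrow> nat \<Rightarrow> int" where
  "paperfold_inf f = (THE P. \<forall>n. let p = paperfold (map f [0..<Suc n])
                                in map P [0..<length p] = p)"

function run_lengths :: "'a list \<Rightarrow> nat list" where
  "run_lengths [] = []"
| "run_lengths (x # xs) =
     Suc (length (takeWhile (\<lambda>y. y = x) xs)) # run_lengths (dropWhile (\<lambda>y. y = x) xs)"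
  by pat_completeness auto
termination
  by (relation "measure length") (auto simp: le_imp_less_Suc length_dropWhile_le)

definition run_starts :: "(nat \<Rightarrow> 'a) \<Rightarrow> nat set" where
  "run_starts P = {n. n = 0 \<or> P n \<noteq> P (n - 1)}"

(* Meaningful only if all runs of P are finite, i.e. if run_starts P is infinite;
   see infinite_run_starts_paperfold_inf below. *)
definition run_lengths_inf :: "(nat \<Rightarrow> 'a) \<Rightarrow> nat \<Rightarrow> nat" where
  "run_lengths_inf P k = enumerate (run_starts P) (Suc k) - enumerate (run_starts P) k"

definition factor_inf :: "'a list \<Rightarrow> (nat \<Rightarrow> 'a) \<Rightarrow> bool" where
  "factor_inf w R \<longleftrightarrow> (\<exists>i. w = map R [i..<i + length w])"

definition palindrome :: "'a list \<Rightarrow> bool" where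
  "palindrome w \<longleftrightarrow> rev w = w"


lemma length_paperfold: "length (paperfold f) = 2 ^ length f - 1"
proof (induction f rule: rev_induct)
  case (snoc a f)
  have "(2::nat) ^ length f \<ge> 1" by simp
  then show ?case using snoc by simp
qed simp

lemma paperfold_map_Suc:
  "paperfold (map f [0..<Suc n]) =
     paperfold (map f [0..<n]) @ [f n] @ map uminus (rev (paperfold (map f [0..<n])))"
  by simp

lemma less_two_power_Suc_minus: "n < (2::nat) ^ Suc n - 1"
  by (induction n) auto

lemma paperfold_nth_mono:
  assumes "m \<le> n" "i < length (paperfold (map f [0..<m]))"
  shows "paperfold (map f [0..<n]) ! i = paperfold (map f [0..<m]) ! i"
  using assms(1)
proof (induction n rule: dec_induct)
  case (step n)
  have "i < length (paperfold (map f [0..<n]))"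
    using assms(2) step(1) unfolding length_paperfold
    by (simp add: diff_less_mono order_less_le_trans diff_le_mono)
  then show ?case
    using step.IH by (simp add: paperfold_map_Suc nth_append)
qed simp

lemma paperfold_inf_ex1:
  "\<exists>!P. \<forall>n. let p = paperfold (map f [0..<Suc n]) in map P [0..<length p] = p"
proof (rule ex1I)
  let ?P = "\<lambda>i. paperfold (map f [0..<Suc i]) ! i"
  show "\<forall>n. let p = paperfold (map f [0..<Suc n]) in map ?P [0..<length p] = p"
  proof
    fix n
    let ?p = "paperfold (map f [0..<Suc n])"
    have "map ?P [0..<length ?p] ! i = ?p ! i" if i: "i < length ?p" for i
    proof -
      have len: "i < length (paperfold (map f [0..<Suc i]))"
        using less_two_power_Suc_minus[of i] by (simp only: length_paperfold) simp
      have "?P i = ?p ! i"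
      proof (cases "i \<le> n")
        case True
        then show ?thesis using paperfold_nth_mono[OF _ len, of "Suc n"] by simp
      next
        case False
        then show ?thesis using paperfold_nth_mono[OF _ i, of "Suc i"] by simp
      qed
      then show ?thesis using i by (simp del: upt_Suc)
    qed
    then have "map ?P [0..<length ?p] = ?p"
      by (intro nth_equalityI) (simp_all del: upt_Suc)
    then show "let p = ?p in map ?P [0..<length p] = p" by (simp add: Let_def del: upt_Suc)
  qed
next
  fix Q
  assume Q: "\<forall>n. let p = paperfold (map f [0..<Suc n]) in map Q [0..<length p] = p"
  show "Q = (\<lambda>i. paperfold (map f [0..<Suc i]) ! i)"
  proof
    fix i
    let ?p = "paperfold (map f [0..<Suc i])"
    have len: "i < length ?p"
      using less_two_power_Suc_minus[of i] by (simp only: length_paperfold) simp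
    have "map Q [0..<length ?p] = ?p" using Q by (simp add: Let_def del: upt_Suc)
    then have "map Q [0..<length ?p] ! i = ?p ! i" by (simp only:)
    then show "Q i = ?p ! i" using len by (simp del: upt_Suc)
  qed
qed

lemma paperfold_inf_prefix:
  "map (paperfold_inf f) [0..<length (paperfold (map f [0..<Suc n]))]
     = paperfold (map f [0..<Suc n])"
  using theI'[OF paperfold_inf_ex1[of f]]
  unfolding paperfold_inf_def Let_def by blast

lemma paperfold_inf_nth:
  assumes "i < 2 ^ Suc n - 1"
  shows "paperfold_inf f i = paperfold (map f [0..<Suc n]) ! i"
proof -
  let ?p = "paperfold (map f [0..<Suc n])"
  have "length ?p = 2 ^ Suc n - 1" by (simp only: length_paperfold) simp
  with assms have "i < length ?p" by simp
  then have "map (paperfold_inf f) [0..<length ?p] ! i = paperfold_inf f i"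
    by (simp del: upt_Suc)
  then show ?thesis by (simp only: paperfold_inf_prefix)
qed

lemma paperfold_inf_mirror:
  assumes "i < 2 ^ Suc n - 1"
  shows "paperfold_inf f (2 ^ Suc (Suc n) - 2 - i) = - paperfold_inf f i"
proof -
  let ?p = "paperfold (map f [0..<Suc n])"
  let ?N = "2 ^ Suc n - 1 :: nat"
  have len: "length ?p = ?N" by (simp only: length_paperfold) simp
  have ge: "(2::nat) ^ Suc n \<ge> 2" by simp
  have idx: "2 ^ Suc (Suc n) - 2 - i = ?N + Suc (?N - Suc i)"
    using assms ge unfolding power_Suc[of 2 "Suc n"] by linarith
  have lt: "?N + Suc (?N - Suc i) < 2 ^ Suc (Suc n) - 1"
    using assms ge unfolding power_Suc[of 2 "Suc n"] by linarith
  have "paperfold_inf f (?N + Suc (?N - Suc i))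
      = (?p @ [f (Suc n)] @ map uminus (rev ?p)) ! (?N + Suc (?N - Suc i))"
    using paperfold_inf_nth[OF lt, of f] paperfold_map_Suc[of f "Suc n"] by (simp only:)
  also have "\<dots> = map uminus (rev ?p) ! (?N - Suc i)"
  proof -
    have "(xs @ [y] @ ys) ! (length xs + Suc k) = ys ! k" for xs ys and y :: int and k
      by (simp add: nth_append)
    from this[of ?p] show ?thesis unfolding len .
  qed
  also have "\<dots> = - (?p ! i)"
  proof -
    have "map uminus (rev xs) ! (length xs - Suc k) = - (xs ! k)" if "k < length xs"
      for xs :: "int list" and k
      using that by (simp add: rev_nth Suc_diff_Suc)
    from this[of i ?p] show ?thesis using assms unfolding len by blast
  qed
  also have "?p ! i = paperfold_inf f i"
    using paperfold_inf_nth[OF assms, of f] by simp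
  finally show ?thesis by (simp only: idx)
qed

lemma infinite_run_starts_paperfold_inf:
  assumes "range f \<subseteq> {-1, 1}"
  shows "infinite (run_starts (paperfold_inf f))"
  unfolding infinite_nat_iff_unbounded
proof
  fix m
  let ?P = "paperfold_inf f"
  have "?P 0 = f 0" using paperfold_inf_nth[of 0 0 f] by (simp add: paperfold_def)
  then have nz: "?P 0 \<noteq> 0" using assms by (metis insertE rangeI singletonD subsetD zero_neq_neg_one zero_neq_one)
  have P2: "?P 2 = - ?P 0" using paperfold_inf_mirror[of 0 0 f] by simp
  let ?K = "2 ^ Suc (Suc (Suc m)) :: nat"
  have K: "?K \<ge> m + 8" by (induction m) auto
  have a: "?P (?K - 2) = - ?P 0"
  proof -
    have "0 < (2::nat) ^ Suc (Suc m) - 1" by (induction m) auto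
    from paperfold_inf_mirror[OF this, of f] show ?thesis by (simp only: diff_zero)
  qed
  have "2 < (2::nat) ^ Suc (Suc m) - 1" by (induction m) auto
  then have b: "?P (?K - 4) = ?P 0"
    using paperfold_inf_mirror[of 2 "Suc m" f] P2 by simp
  have "?P (?K - 2) \<noteq> ?P (?K - 3) \<or> ?P (?K - 3) \<noteq> ?P (?K - 4)"
    using a b nz by auto
  moreover have "?K - 2 - 1 = ?K - 3" "?K - 3 - 1 = ?K - 4" "?K - 3 > m" "?K - 2 > m"
    using K by linarith+
  ultimately have "?K - 2 \<in> run_starts ?P \<or> ?K - 3 \<in> run_starts ?P"
    unfolding run_starts_def mem_Collect_eq by metis
  then show "\<exists>n>m. n \<in> run_starts ?P"
    using \<open>?K - 3 > m\<close> \<open>?K - 2 > m\<close> by blast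
qed

end

theory Submission
  imports Defs
begin

text \<open>The term of a paperfolding sequence at the one-based position \<open>2 ^ k * (2 * q + 1)\<close> is
  \<open>(-1) ^ q * f\<^sub>k\<close>; hence it changes sign under the shift by \<open>2 ^ (k + 1)\<close>.  Removing the first and
  last letter of a palindrome leaves a palindrome, so by induction only the words \<open>a c a\<close> with \<open>c\<close>
  empty or in the list have to be considered, and each such word outside the list
  contradicts the sign changes for \<open>k < 3\<close>, whatever the residue modulo 8 of its position.\<close>

section \<open>Letters of a finite paperfolding word and their sign changes\<close>

text \<open>Induction on the last folding instruction. The new middle letter stands at the one-based
  position \<open>2 ^ length f\<close>, a power of two, so there \<open>q = 0\<close>. A position
  beyond the middle is the mirror image of one before it with the same exponent \<open>k\<close>;
  its \<open>q\<close> has the opposite parity, which compensates the negation in the mirrored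
  half.\<close>

lemma paperfold_nth:
  assumes "2 ^ k * (2 * q + 1) < (2::nat) ^ length f"
  shows "paperfold f ! (2 ^ k * (2 * q + 1) - 1) = (-1) ^ q * f ! k"
  using assms
proof (induction f arbitrary: q rule: rev_induct)
  case (snoc a f)
  let ?m = "length f" and ?p = "paperfold f" and ?N = "2 ^ k * (2 * q + 1) :: nat"
  have N0: "0 < ?N" by simp
  have lt: "?N < 2 * 2 ^ ?m" using snoc.prems by simp
  have "(2::nat) ^ k \<le> ?N" by simp
  with lt have "(2::nat) ^ k < 2 ^ Suc ?m" unfolding power_Suc by linarith
  then have km: "k \<le> ?m" by (metis less_Suc_eq_le one_less_numeral_iff power_less_imp_less_exp semiring_norm(76))
  have len: "length ?p = 2 ^ ?m - 1" by (rule length_paperfold)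
  consider "?N < 2 ^ ?m" | "?N = 2 ^ ?m" | "2 ^ ?m < ?N" by linarith
  then show ?case
  proof cases
    case 1
    have "(2::nat) ^ k \<le> ?N" by simp
    with 1 have "(2::nat) ^ k < 2 ^ ?m" by linarith
    then have "k < ?m" by simp
    moreover have "?N - 1 < length ?p" using 1 N0 len by linarith
    ultimately show ?thesis using snoc.IH[OF 1] by (simp add: nth_append)
  next
    case 2
    have "k = ?m"
    proof (rule ccontr)
      assume "k \<noteq> ?m"
      then have "k < ?m" using km by simp
      then obtain j where "?m = k + Suc j" by (metis add_Suc_right less_iff_Suc_add)
      then have "2 ^ k * (2 * q + 1) = 2 ^ k * (2 * 2 ^ j :: nat)" using 2 by (simp add: power_add)
      then have "2 * q + 1 = 2 * 2 ^ j" by (metis mult_cancel1 power_not_zero zero_neq_numeral)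
      then show False by presburger
    qed
    with 2 have "q = 0" by simp
    with \<open>k = ?m\<close> show ?thesis using len by (simp add: nth_append)
  next
    case 3
    have "k < ?m"
    proof (rule ccontr)
      assume "\<not> k < ?m"
      with km have k: "k = ?m" by simp
      with lt have "2 * q + 1 < 2" by (metis mult.commute nat_mult_less_cancel_disj)
      with 3 k show False by simp
    qed
    then obtain j where j: "?m = k + Suc j" by (metis add_Suc_right less_iff_Suc_add)
    \<comment> \<open>Chosen so that \<open>?M\<close> below is the mirror position
      \<open>2 ^ (?m + 1) - ?N\<close>; note that \<open>2 * 2 ^ j\<close> is
      \<open>2 ^ (?m - k)\<close>.\<close>
    define q' where "q' = 2 * 2 ^ j - q - 1"
    have "2 ^ k * (2 * q + 1) < 2 ^ k * (2 * (2 * 2 ^ j) :: nat)"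
      using lt unfolding j by (simp add: power_add algebra_simps)
    then have "2 * q + 1 < 2 * (2 * 2 ^ j)" by (metis nat_mult_less_cancel_disj)
    then have q: "q + q' + 1 = 2 * 2 ^ j" unfolding q'_def by linarith
    let ?M = "2 ^ k * (2 * q' + 1) :: nat"
    have "?N + ?M = 2 ^ k * (2 * (q + q' + 1))" by (simp add: algebra_simps)
    also have "\<dots> = 2 * 2 ^ ?m" unfolding q j by (simp add: power_add)
    finally have NM: "?N + ?M = 2 * 2 ^ ?m" .
    then have M: "?M < 2 ^ ?m" using 3 by linarith
    have "0 < ?M" by simp
    have ix: "?N - 1 = length ?p + Suc (length ?p - Suc (?M - 1))"
      and M1: "?M - 1 < length ?p"
      using NM 3 M len N0 \<open>0 < ?M\<close> by linarith+
    have "paperfold (f @ [a]) ! (?N - 1) = map uminus (rev ?p) ! (length ?p - Suc (?M - 1))"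
      unfolding ix paperfold_snoc by (simp add: nth_append)
    also have "\<dots> = - (?p ! (?M - 1))"
    proof -
      have "map uminus (rev ys) ! (length ys - Suc i) = - ys ! i" if "i < length ys"
        for ys :: "int list" and i
        using that by (simp add: rev_nth Suc_diff_Suc)
      then show ?thesis using M1 .
    qed
    also have "\<dots> = - ((-1) ^ q' * f ! k)" using snoc.IH[OF M] by simp
    also have "\<dots> = (-1) ^ q * f ! k"
    proof -
      have "even q \<longleftrightarrow> odd q'" using q by presburger
      then show ?thesis by (cases "even q") auto
    qed
    finally show ?thesis using \<open>k < ?m\<close> by (simp add: nth_append)
  qed
qed simp

text \<open>The letter \<open>c\<close> in front fills position 0, so that list indices become
  one-based positions. The congruence says that \<open>k\<close> is the exact exponent of 2 in
  \<open>n\<close>, which excludes \<open>n = 0\<close>; the shift raises \<open>q\<close> by one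
  and thus flips the sign \<open>(-1) ^ q\<close>.\<close>

lemma Cons_paperfold_shift:
  assumes "n + 2 ^ Suc k < length (c # paperfold f)" "n mod 2 ^ Suc k = 2 ^ k"
  shows "(c # paperfold f) ! (n + 2 ^ Suc k) = - (c # paperfold f) ! n"
proof -
  define q where "q = n div 2 ^ Suc k"
  have "n = 2 ^ Suc k * (n div 2 ^ Suc k) + n mod 2 ^ Suc k" by simp
  then have n: "n = 2 ^ k * (2 * q + 1)" unfolding assms(2) q_def by (simp add: algebra_simps)
  then have n': "n + 2 ^ Suc k = 2 ^ k * (2 * Suc q + 1)" by (simp add: algebra_simps)
  have "length (c # paperfold f) = 2 ^ length f" by (simp add: length_paperfold)
  with assms(1) have lt: "n + 2 ^ Suc k < 2 ^ length f" by simp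
  have "paperfold f ! (n - 1) = (-1) ^ q * f ! k"
    using paperfold_nth[of k q f] lt unfolding n by linarith
  moreover have "paperfold f ! (n + 2 ^ Suc k - 1) = (-1) ^ Suc q * f ! k"
    using paperfold_nth[of k "Suc q" f] lt unfolding n' by blast
  moreover have "0 < n" unfolding n by simp
  ultimately show ?thesis by (simp add: nth_Cons')
qed

section \<open>A finite test excluding factors of paperfolding words\<close>

text \<open>Here \<open>r\<close> is a conceivable residue modulo 8 of the starting position of
  \<open>xs\<close>; for \<open>k < 3\<close> it determines the residue modulo
  \<open>2 ^ Suc k\<close>. Whatever \<open>r\<close> is, some required sign change must fail inside
  \<open>xs\<close>. The truncated subtraction leaves no \<open>j\<close> if \<open>xs\<close> is
  too short for the shift. Bounded quantifiers over lists let the test be evaluated.\<close>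

definition non_paperfolding :: "int list \<Rightarrow> bool" where
  "non_paperfolding xs \<longleftrightarrow> (\<forall>r\<in>set [0..<8]. \<exists>k\<in>set [0..<3]. \<exists>j\<in>set [0..<length xs - 2 ^ Suc k].
     (r + j) mod 2 ^ Suc k = 2 ^ k \<and> xs ! (j + 2 ^ Suc k) = xs ! j)"

text \<open>At the actual residue of the starting position the test yields two equal entries that
  must also be opposite, hence an entry 0.\<close>

lemma non_paperfolding_not_sublist:
  assumes xs: "non_paperfolding xs" and c: "0 \<notin> set (c # paperfold f)"
  shows "\<not> sublist xs (c # paperfold f)"
proof
  assume "sublist xs (c # paperfold f)"
  then obtain us vs where eq: "c # paperfold f = us @ xs @ vs" by (auto simp: sublist_def)
  have "length us mod 8 \<in> set [0..<8]" by simp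
  then obtain k j where k: "k < 3" and j: "j < length xs - 2 ^ Suc k"
    and r: "(length us mod 8 + j) mod 2 ^ Suc k = 2 ^ k" and same: "xs ! (j + 2 ^ Suc k) = xs ! j"
    using xs unfolding non_paperfolding_def by (metis atLeastLessThan_iff set_upt)
  have "2 ^ Suc k dvd (2 ^ 3 :: nat)" using k by (intro le_imp_power_dvd) simp
  then have "2 ^ Suc k dvd (8 :: nat)" by simp
  then have "(length us + j) mod 2 ^ Suc k = 2 ^ k"
    using r by (metis mod_add_left_eq mod_mod_cancel)
  moreover have jl: "j + 2 ^ Suc k < length xs" "j < length xs" using j by linarith+
  moreover have "length us + j + 2 ^ Suc k < length (c # paperfold f)" using j unfolding eq by simp
  ultimately have "(us @ xs @ vs) ! (length us + j + 2 ^ Suc k) = - (us @ xs @ vs) ! (length us + j)"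
    using Cons_paperfold_shift[of "length us + j" k c f] unfolding eq by blast
  moreover have "(us @ xs @ vs) ! (length us + j + 2 ^ Suc k) = xs ! (j + 2 ^ Suc k)"
    "(us @ xs @ vs) ! (length us + j) = xs ! j"
    using jl by (simp_all add: nth_append del: power_Suc)
  ultimately have "xs ! j = 0" using same by linarith
  moreover have "xs ! j \<in> set (c # paperfold f)" unfolding eq using j by simp
  ultimately show False using c by simp
qed

section \<open>Rebuilding words from their run lengths\<close>

fun of_runs :: "int \<Rightarrow> nat list \<Rightarrow> int list" where
  "of_runs s [] = []"
| "of_runs s (n # ns) = replicate n s @ of_runs (- s) ns"

lemma of_runs_append: "of_runs s (ms @ ns) = of_runs s ms @ of_runs ((-1) ^ length ms * s) ns"
  by (induction ms arbitrary: s) auto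

text \<open>With only two letters, the letter after a run of \<open>x\<close> is \<open>- x\<close>,
  so alternating signs recover the word from its first letter.\<close>

lemma of_runs_run_lengths:
  assumes "set xs \<subseteq> {-1, 1}" "xs \<noteq> []"
  shows "of_runs (hd xs) (run_lengths xs) = xs"
  using assms
proof (induction xs rule: run_lengths.induct)
  case (2 x xs)
  let ?t = "takeWhile (\<lambda>y. y = x) xs" and ?d = "dropWhile (\<lambda>y. y = x) xs"
  have t: "replicate (length ?t) x = ?t"
    by (metis (mono_tags, lifting) replicate_length_same set_takeWhileD)
  show ?case
  proof (cases "?d = []")
    case True
    then have "?t = xs" by (simp add: takeWhile_eq_all_conv)
    then show ?thesis using t True
      by (simp only: run_lengths.simps of_runs.simps list.sel replicate_Suc append_Nil2 append_Cons)
  next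
    case False
    have "hd ?d \<noteq> x" using False hd_dropWhile by blast
    moreover have "set ?d \<subseteq> {-1, 1}" using 2(2) set_dropWhileD by fastforce
    moreover have "hd ?d \<in> set ?d" using False by simp
    ultimately have "hd ?d = - x" using 2(2) by auto
    then have "of_runs (- x) (run_lengths ?d) = ?d" using 2(1) False \<open>set ?d \<subseteq> {-1, 1}\<close> by simp
    then show ?thesis using t by simp
  qed
qed simp

lemma run_lengths_pos: "n \<in> set (run_lengths xs) \<Longrightarrow> 0 < n"
  by (induction xs rule: run_lengths.induct) auto

text \<open>The run before \<open>w\<close> is cut down to its last letter and the run after
  \<open>w\<close> to its first, so the unknown lengths \<open>a\<close> and \<open>b\<close>
  disappear.\<close>

lemma of_runs_shrink:
  assumes "0 < a" "0 < b"
  shows "sublist (of_runs s (1 # w @ [1])) (of_runs s (a # w @ [b]))"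
proof -
  obtain a' b' where "a = Suc a'" "b = Suc b'" using assms by (metis gr0_implies_Suc)
  then have "of_runs s (a # w @ [b]) = replicate a' s @ of_runs s (1 # w @ [1])
      @ replicate b' ((-1) ^ length w * - s)"
    by (simp add: of_runs_append replicate_append_same)
  then show ?thesis by (metis sublist_appendI)
qed

text \<open>The letters added at both ends form new runs of length 1. So \<open>w\<close> has a
  neighbouring run on each side even at an end of the run-length sequence, and one letter of each
  neighbour suffices to delimit the runs of \<open>w\<close>.\<close>

lemma sublist_of_runs:
  assumes "sublist w (run_lengths xs)" "set xs \<subseteq> {-1, 1}" "xs \<noteq> []"
  shows "\<exists>s\<in>{-1, 1}. sublist (of_runs s (1 # w @ [1])) (- hd xs # xs @ [- last xs])"
proof -
  let ?R = "run_lengths xs"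
  have hd: "hd xs \<in> {-1, 1}" and last: "last xs \<in> {-1, 1}"
    using assms(2,3) by (auto dest: subsetD[OF _ hd_in_set] subsetD[OF _ last_in_set])
  obtain us vs where R: "?R = us @ w @ vs" using assms(1) by (auto simp: sublist_def)
  \<comment> \<open>The lengths of the runs next to \<open>w\<close>; the default 1 is the added run
    when \<open>w\<close> reaches an end.\<close>
  define a where "a = last (1 # us)"
  define b where "b = hd (vs @ [1])"
  have pos: "\<forall>n\<in>set us \<union> set vs. 0 < n" using R run_lengths_pos[of _ xs] by auto
  then have a: "0 < a" unfolding a_def by (cases us rule: rev_cases) auto
  from pos have b: "0 < b" unfolding b_def by (cases vs) auto
  have split: "1 # ?R @ [1] = butlast (1 # us) @ (a # w @ [b]) @ tl (vs @ [1])"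
  proof -
    have "1 # us = butlast (1 # us) @ [a]" unfolding a_def by (rule append_butlast_last_id[symmetric]) simp
    moreover have "vs @ [1] = b # tl (vs @ [1])" unfolding b_def by (rule hd_Cons_tl[symmetric]) simp
    ultimately show ?thesis unfolding R by (metis append_Cons append_Nil append_assoc)
  qed
  have xs: "of_runs (hd xs) ?R = xs" by (rule of_runs_run_lengths[OF assms(2,3)])
  \<comment> \<open>Signs alternate, so a further run after the last one would carry the sign
    \<open>- last xs\<close>.\<close>
  have lst: "(-1) ^ length ?R * hd xs = - last xs"
  proof -
    have "?R \<noteq> []" using assms(3) by (cases xs) auto
    then obtain ms n where ms: "?R = ms @ [n]" by (metis rev_exhaust)
    then have "0 < n" using run_lengths_pos[of n xs] by simp
    moreover have "xs = of_runs (hd xs) ms @ replicate n ((-1) ^ length ms * hd xs)"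
      using xs unfolding ms of_runs_append by simp
    ultimately have "last xs = (-1) ^ length ms * hd xs"
      by (metis last_append last_replicate less_numeral_extra(3) replicate_empty)
    then show ?thesis unfolding ms by simp
  qed
  have ext: "of_runs (- hd xs) (1 # ?R @ [1]) = - hd xs # xs @ [- last xs]"
    using lst xs by (simp add: of_runs_append)
  \<comment> \<open>The sign of the run of length \<open>a\<close> in the extended word.\<close>
  define s where "s = (-1) ^ length (butlast (1 # us)) * (- hd xs)"
  have "s \<in> {-1, 1}" using hd unfolding s_def by (auto simp: minus_one_power_iff)
  moreover have "sublist (of_runs s (a # w @ [b])) (- hd xs # xs @ [- last xs])"
    unfolding ext[symmetric] split of_runs_append[of _ "butlast (1 # us)"] s_def[symmetric]
      of_runs_append[of _ "a # w @ [b]"] by (rule sublist_appendI)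
  ultimately show ?thesis using of_runs_shrink[OF a b] sublist_order.order_trans by blast
qed

lemma set_paperfold: "set f \<subseteq> {-1, 1} \<Longrightarrow> set (paperfold f) \<subseteq> {-1, 1}"
  by (induction f rule: rev_induct) auto

text \<open>Both closing letters are compatible with paperfolding: the left one is the free letter
  at position 0, and the right one is the middle letter produced by one further folding instruction.
  Hence the test applies to the closed-up word.\<close>

lemma non_paperfolding_run_lengths:
  assumes f: "set f \<subseteq> {-1, 1}" and w: "w \<noteq> []"
    and np: "\<And>s. s \<in> {-1, 1} \<Longrightarrow> non_paperfolding (of_runs s (1 # w @ [1]))"
  shows "\<not> sublist w (run_lengths (paperfold f))"
proof
  assume sub: "sublist w (run_lengths (paperfold f))"
  let ?p = "paperfold f"
  let ?c = "- hd ?p" and ?d = "- last ?p"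
  have p: "set ?p \<subseteq> {-1, 1}" by (rule set_paperfold[OF f])
  have ne: "?p \<noteq> []" using sub w by auto
  obtain s where s: "s \<in> {-1, 1}" "sublist (of_runs s (1 # w @ [1])) (?c # ?p @ [?d])"
    using sublist_of_runs[OF sub p ne] by blast
  have d: "hd ?p \<in> {-1, 1}" "last ?p \<in> {-1, 1}"
    using p ne by (auto dest: subsetD[OF _ hd_in_set] subsetD[OF _ last_in_set])
  then have "set (f @ [?d]) \<subseteq> {-1, 1}" using f by auto
  then have "0 \<notin> set (?c # paperfold (f @ [?d]))" using set_paperfold[of "f @ [?d]"] d by fastforce
  moreover have "sublist (?c # ?p @ [?d]) (?c # paperfold (f @ [?d]))"
    by (simp add: sublist_append_rightI[of "?c # ?p @ [?d]", simplified])
  ultimately show False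
    using non_paperfolding_not_sublist[OF np[OF s(1)]] s(2) sublist_order.order_trans by blast
qed

section \<open>Palindromic factors of finite run-length sequences\<close>

abbreviation (input) run_palindromes :: "nat list set" where
  "run_palindromes \<equiv> {[1], [2], [3], [2,2], [2,1,2], [2,3,2], [1,2,3,2,1], [3,2,1,2,3]}"

text \<open>Nine cores \<open>c\<close> and three letters \<open>a\<close> give 27 words. Five of
  them lie in the list; the other 22 form \<open>?bad\<close>, and each fails the test with either
  starting sign once it is closed by a letter on both sides.\<close>

lemma non_paperfolding_extension:
  assumes "c \<in> insert [] run_palindromes" "a \<in> {1, 2, 3}" "s \<in> {-1, 1}"
    "a # c @ [a] \<notin> run_palindromes"
  shows "non_paperfolding (of_runs s (1 # (a # c @ [a]) @ [1]))"
proof -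
  let ?bad = "[[1,1], [3,3], [1,1,1], [3,1,3], [1,2,1], [2,2,2], [3,2,3], [1,3,1], [3,3,3],
    [1,2,2,1], [2,2,2,2], [3,2,2,3], [1,2,1,2,1], [2,2,1,2,2], [2,2,3,2,2], [3,2,3,2,3],
    [1,1,2,3,2,1,1], [2,1,2,3,2,1,2], [3,1,2,3,2,1,3],
    [1,3,2,1,2,3,1], [2,3,2,1,2,3,2], [3,3,2,1,2,3,3]]"
  have "\<forall>c\<in>insert [] run_palindromes. \<forall>a\<in>{1, 2, 3}.
      a # c @ [a] \<in> run_palindromes \<or> a # c @ [a] \<in> set ?bad"
    by simp
  then have "a # c @ [a] \<in> set ?bad" using assms(1,2,4) by meson
  moreover have "\<forall>s\<in>{-1, 1}. \<forall>w\<in>set ?bad. non_paperfolding (of_runs s (1 # w @ [1]))"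
    by code_simp
  ultimately show ?thesis using assms(3) by meson
qed

text \<open>Four consecutive positions contain two odd ones at distance 2, whose letters are
  opposite by the case \<open>k = 0\<close>; so four equal letters are impossible.\<close>

lemma run_lengths_paperfold_le_3:
  assumes f: "set f \<subseteq> {-1, 1}" and n: "n \<in> set (run_lengths (paperfold f))"
  shows "n \<in> {1, 2, 3}"
proof (rule ccontr)
  assume "n \<notin> {1, 2, 3}"
  moreover have "0 < n" using run_lengths_pos[OF n] .
  ultimately have "4 \<le> n" by auto
  then obtain m where m: "n = 4 + m" using le_Suc_ex by blast
  let ?p = "paperfold f"
  have p: "set ?p \<subseteq> {-1, 1}" by (rule set_paperfold[OF f])
  have ne: "?p \<noteq> []" using n by auto
  then have hd: "hd ?p \<in> {-1, 1}" using p by (auto dest: subsetD[OF _ hd_in_set])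
  obtain us vs where R: "run_lengths ?p = us @ n # vs" using n by (meson split_list)
  define s where "s = (-1) ^ length us * hd ?p"
  have s: "s \<in> {-1, 1}" using hd unfolding s_def by (auto simp: minus_one_power_iff)
  have "?p = of_runs (hd ?p) us @ replicate 4 s @ replicate m s @ of_runs (- s) vs"
    using of_runs_run_lengths[OF p ne] unfolding R of_runs_append s_def m
    by (simp add: replicate_add)
  then have "sublist (replicate 4 s) ?p" by (metis sublist_appendI)
  \<comment> \<open>The nonzero letter 1 is put at position 0, as the test expects.\<close>
  then have "sublist (replicate 4 s) (1 # ?p)" by (metis sublist_Cons_right)
  moreover have "\<forall>s\<in>{-1, 1}. non_paperfolding (replicate 4 s)" by code_simp
  moreover have "0 \<notin> set (1 # ?p)" using p by auto
  ultimately show False using non_paperfolding_not_sublist s by blast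
qed

lemma palindrome_factor_paperfold:
  assumes f: "set f \<subseteq> {-1, 1}"
    and "palindrome w" "w \<noteq> []" "sublist w (run_lengths (paperfold f))"
  shows "w \<in> run_palindromes"
  using assms(2-)
proof (induction w rule: length_induct)
  case (1 w)
  obtain a v where w: "w = a # v" using 1(3) by (cases w) auto
  have "set w \<subseteq> set (run_lengths (paperfold f))" using 1(4) by (rule set_mono_sublist)
  then have a: "a \<in> {1, 2, 3}" using run_lengths_paperfold_le_3[OF f, of a] w by auto
  show ?case
  proof (cases v rule: rev_cases)
    case Nil
    then show ?thesis using a w by auto
  next
    case (snoc c b)
    have "b # rev c @ [a] = a # c @ [b]" using 1(2) unfolding w snoc palindrome_def
      by (simp only: rev.simps rev_append append.simps append_assoc)
    then have "b = a" "rev c = c" by (metis list.inject, metis append1_eq_conv list.inject)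
    then have w': "w = a # c @ [a]" and c: "palindrome c"
      unfolding w snoc palindrome_def by simp_all
    have "sublist c w" unfolding w' by (metis append_Cons append_Nil sublist_appendI)
    then have "sublist c (run_lengths (paperfold f))" using 1(4) sublist_order.order_trans by blast
    moreover have "length c < length w" unfolding w' by simp
    ultimately have "c \<noteq> [] \<longrightarrow> c \<in> run_palindromes" using 1(1) c by meson
    then have ic: "c \<in> insert [] run_palindromes" by (simp only: insert_iff) meson
    show ?thesis
    proof (rule ccontr)
      assume nw: "w \<notin> run_palindromes"
      have "non_paperfolding (of_runs s (1 # w @ [1]))" if "s \<in> {-1, 1}" for s
        unfolding w' by (rule non_paperfolding_extension[OF ic a that nw[unfolded w']])
      then show False using non_paperfolding_run_lengths[OF f 1(3)] 1(4) by (simp only:)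
    qed
  qed
qed

section \<open>Passing between finite and infinite run-length sequences\<close>

lemma run_lengths_append:
  assumes "xs \<noteq> []" "ys \<noteq> []" "last xs \<noteq> hd ys"
  shows "run_lengths (xs @ ys) = run_lengths xs @ run_lengths ys"
  using assms
proof (induction xs rule: run_lengths.induct)
  case (2 x xs)
  let ?d = "dropWhile (\<lambda>y. y = x) xs"
  show ?case
  proof (cases "?d = []")
    case True
    then have all: "\<forall>y\<in>set xs. y = x" by simp
    then have "last (x # xs) = x" by (metis last_in_set list.distinct(1) set_ConsD)
    then have "hd ys \<noteq> x" using 2(4) by simp
    then have "takeWhile (\<lambda>y. y = x) ys = []" "dropWhile (\<lambda>y. y = x) ys = ys"
      using 2(3) by (cases ys; simp)+
    moreover have "takeWhile (\<lambda>y. y = x) xs = xs" using all by (simp add: takeWhile_eq_all_conv)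
    ultimately show ?thesis using all True
      by (simp add: takeWhile_append2 dropWhile_append2 del: takeWhile_eq_all_conv dropWhile_eq_Nil_conv)
  next
    case False
    then obtain y where y: "y \<in> set xs" "y \<noteq> x" by (auto simp: dropWhile_eq_Nil_conv)
    have "last ?d = last xs" using False by (metis last_appendR takeWhile_dropWhile_id)
    then have "last ?d \<noteq> hd ys" using 2(4) y by (auto split: if_splits)
    then have "run_lengths (?d @ ys) = run_lengths ?d @ run_lengths ys" using 2(1,3) False by blast
    then show ?thesis using y by (simp add: takeWhile_append1 dropWhile_append1)
  qed
qed simp

lemma run_lengths_constant:
  "n > 0 \<Longrightarrow> run_lengths (replicate n x) = [n]"
  by (cases n) (auto simp: dropWhile_eq_Nil_conv takeWhile_eq_all_conv[THEN iffD2])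

text \<open>The letter changes at a positive run start, so no run straddles the cut; the run start 0
  leaves an empty left part.\<close>

lemma run_lengths_split_at_run_start:
  assumes "i \<in> run_starts P" "i < m"
  shows "run_lengths (map P [0..<m]) = run_lengths (map P [0..<i]) @ run_lengths (map P [i..<m])"
proof (cases "i = 0")
  case False
  have "[0..<m] = [0..<i] @ [i..<m]" using assms(2) upt_add_eq_append[of 0 i "m - i"] by simp
  moreover have "last (map P [0..<i]) \<noteq> hd (map P [i..<m])"
    using assms False by (simp add: run_starts_def last_map hd_map)
  ultimately show ?thesis using run_lengths_append[of "map P [0..<i]" "map P [i..<m]"] assms(2) False
    by simp
qed simp

text \<open>A prefix ending just before a run start consists of complete runs, so truncation does
  not shorten its last run.\<close>

lemma run_lengths_prefix:
  assumes inf: "infinite (run_starts P)"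
  shows "run_lengths (map P [0..<enumerate (run_starts P) k]) = map (run_lengths_inf P) [0..<k]"
proof (induction k)
  case 0
  have "(LEAST n. n \<in> run_starts P) = 0" by (intro Least_equality) (auto simp: run_starts_def)
  then show ?case by (simp add: enumerate_0)
next
  case (Suc k)
  let ?e = "enumerate (run_starts P)"
  have in_e: "?e k \<in> run_starts P" by (rule enumerate_in_set[OF inf])
  have lt: "?e k < ?e (Suc k)" by (rule enumerate_step[OF inf])
  \<comment> \<open>A change of letter here would be a run start strictly between two consecutive
    ones in the enumeration.\<close>
  have const: "P (?e k + j) = P (?e k)" if "?e k + j < ?e (Suc k)" for j
    using that
  proof (induction j)
    case (Suc j)
    have "?e k + Suc j \<notin> run_starts P"
    proof
      assume "?e k + Suc j \<in> run_starts P"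
      then obtain l where "?e l = ?e k + Suc j" using enumerate_Ex[OF inf] by metis
      then have "?e k < ?e l" "?e l < ?e (Suc k)" using Suc.prems by simp_all
      then show False using inf by simp
    qed
    then show ?case using Suc by (simp add: run_starts_def)
  qed simp
  have "map P [?e k..<?e (Suc k)] = replicate (?e (Suc k) - ?e k) (P (?e k))"
    by (intro nth_equalityI) (auto intro!: const)
  then have "run_lengths (map P [?e k..<?e (Suc k)]) = [run_lengths_inf P k]"
    using lt run_lengths_constant by (metis run_lengths_inf_def zero_less_diff)
  then show ?case using run_lengths_split_at_run_start[OF in_e lt] Suc.IH by simp
qed

lemma factor_inf_finite:
  assumes f: "range f \<subseteq> {-1, 1}" and w: "factor_inf w (run_lengths_inf (paperfold_inf f))"
  shows "\<exists>g. set g \<subseteq> {-1, 1} \<and> sublist w (run_lengths (paperfold g))"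
proof -
  let ?P = "paperfold_inf f"
  have inf: "infinite (run_starts ?P)" by (rule infinite_run_starts_paperfold_inf[OF f])
  obtain i where i: "w = map (run_lengths_inf ?P) [i..<i + length w]"
    using w unfolding factor_inf_def by blast
  \<comment> \<open>The first position after the runs counted by \<open>w\<close>. The word folded
    with \<open>n + 1\<close> instructions has length \<open>2 ^ (n + 1) - 1 > n\<close>, so it
    contains these runs completely.\<close>
  define n where "n = enumerate (run_starts ?P) (i + length w)"
  define g where "g = map f [0..<Suc n]"
  have "n < length (paperfold g)"
    using less_two_power_Suc_minus[of n] unfolding g_def length_paperfold by simp
  moreover have "n \<in> run_starts ?P" unfolding n_def by (rule enumerate_in_set[OF inf])
  moreover have "paperfold g = map ?P [0..<length (paperfold g)]"
    unfolding g_def by (rule paperfold_inf_prefix[symmetric])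
  ultimately have "run_lengths (paperfold g) =
      map (run_lengths_inf ?P) [0..<i + length w] @ run_lengths (map ?P [n..<length (paperfold g)])"
    using run_lengths_split_at_run_start run_lengths_prefix[OF inf] unfolding n_def by metis
  also have "[0..<i + length w] = [0..<i] @ [i..<i + length w]" by (rule upt_add_eq_append) simp
  finally have "sublist w (run_lengths (paperfold g))"
    using i by (metis append_assoc map_append sublist_appendI)
  moreover have "set g \<subseteq> {-1, 1}" using f unfolding g_def by auto
  ultimately show ?thesis by blast
qed

lemma sublist_paperfold_inf:
  assumes g: "set g \<subseteq> {-1, 1}" and w: "w \<noteq> []" "sublist w (run_lengths (paperfold g))"
  shows "\<exists>f. range f \<subseteq> {-1, 1} \<and> factor_inf w (run_lengths_inf (paperfold_inf f))"
proof -
  let ?p = "paperfold g"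
  have ne: "?p \<noteq> []" using w by auto
  \<comment> \<open>Continuing with the opposite of the last letter closes the last run of \<open>paperfold g\<close>.\<close>
  define f where "f = (\<lambda>n. if n < length g then g ! n else - last ?p)"
  have "last ?p \<in> {-1, 1}" using set_paperfold[OF g] ne last_in_set by blast
  then have "f n \<in> {-1, 1}" for n
  proof (cases "n < length g")
    case True
    then show ?thesis using subsetD[OF g nth_mem[OF True]] by (simp only: f_def if_True)
  qed (auto simp: f_def)
  then have f: "range f \<subseteq> {-1, 1}" by blast
  let ?P = "paperfold_inf f" and ?m = "length ?p"
  have inf: "infinite (run_starts ?P)" by (rule infinite_run_starts_paperfold_inf[OF f])
  have "map f [0..<length g] = g" unfolding f_def by (intro nth_equalityI) auto
  then have ext: "paperfold (map f [0..<Suc (length g)]) = ?p @ [- last ?p] @ map uminus (rev ?p)"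
    by (simp add: f_def)
  have P: "?P j = (?p @ [- last ?p] @ map uminus (rev ?p)) ! j" if "j \<le> ?m" for j
  proof -
    have "?m < 2 ^ Suc (length g) - 1" unfolding length_paperfold power_Suc
      by (simp add: less_diff_conv)
    then show ?thesis using paperfold_inf_nth[of j "length g" f] that unfolding ext by simp
  qed
  have pm: "map ?P [0..<?m] = ?p" using P by (intro nth_equalityI) (auto simp: nth_append)
  have "?P (?m - 1) = last ?p" using P[of "?m - 1"] ne by (simp add: nth_append last_conv_nth)
  moreover have "?P ?m = - last ?p" using P[of ?m] by (simp add: nth_append)
  \<comment> \<open>As \<open>?m\<close> is a run start of the infinite sequence, its prefix
    \<open>?p\<close> ends with a complete run and both notions of run length agree on it.\<close>
  ultimately have "?m \<in> run_starts ?P" using \<open>last ?p \<in> {-1, 1}\<close> unfolding run_starts_def by auto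
  then obtain k where "enumerate (run_starts ?P) k = ?m" using enumerate_Ex[OF inf] by metis
  then have R: "run_lengths ?p = map (run_lengths_inf ?P) [0..<k]"
    using run_lengths_prefix[OF inf, of k] pm by simp
  obtain us vs where "run_lengths ?p = us @ w @ vs" using w(2) by (auto simp: sublist_def)
  then have eq: "map (run_lengths_inf ?P) [0..<k] = us @ w @ vs" using R by simp
  then have len: "k = length us + length w + length vs" by (metis add.assoc diff_zero length_append length_map length_upt)
  have "w ! j = run_lengths_inf ?P (length us + j)" if "j < length w" for j
    using arg_cong[OF eq, of "\<lambda>xs. xs ! (length us + j)"] that len by (simp add: nth_append)
  then have "w = map (run_lengths_inf ?P) [length us..<length us + length w]"
    by (intro nth_equalityI) auto
  then show ?thesis using f unfolding factor_inf_def by blast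
qed

section \<open>Occurrence of all eight palindromes\<close>

lemma run_palindromes_occur:
  assumes "w \<in> run_palindromes"
  shows "\<exists>f. set f \<subseteq> {-1, 1} \<and> sublist w (run_lengths (paperfold f))"
proof -
  \<comment> \<open>Five equal folds already exhibit every word except \<open>[1,2,3,2,1]\<close>;
    that one ends the run-length sequence of \<open>?g\<close>.\<close>
  let ?f = "[1,1,1,1,1] :: int list" and ?g = "[1,-1,1,1] :: int list"
  have f: "run_lengths (paperfold ?f) = [2,1,2,2,3,2,1,2,3,1,2,3,2,2,1,2]" by code_simp
  have g: "run_lengths (paperfold ?g) = [1,2,3,1,2,3,2,1]" by code_simp
  have "sublist w (run_lengths (paperfold ?f)) \<or> sublist w (run_lengths (paperfold ?g))"
    using assms unfolding f g by (auto simp: sublist_Cons_right)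
  moreover have "set ?f \<subseteq> {-1, 1}" "set ?g \<subseteq> {-1, 1}" by auto
  ultimately show ?thesis by blast
qed

theorem theorem8:
  shows "let W = {[1], [2], [3], [2,2], [2,1,2], [2,3,2], [1,2,3,2,1], [3,2,1,2,3]} :: nat list set
    in (\<forall>f :: int list. set f \<subseteq> {-1, 1} \<longrightarrow>
          (\<forall>w. w \<noteq> [] \<and> palindrome w \<and> sublist w (run_lengths (paperfold f)) \<longrightarrow> w \<in> W))
     \<and> (\<forall>f :: nat \<Rightarrow> int. range f \<subseteq> {-1, 1} \<longrightarrow>
          (\<forall>w. w \<noteq> [] \<and> palindrome w \<and> factor_inf w (run_lengths_inf (paperfold_inf f)) \<longrightarrow> w \<in> W))
     \<and> (\<forall>w\<in>W. \<exists>f :: int list. set f \<subseteq> {-1, 1} \<and> sublist w (run_lengths (paperfold f)))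
     \<and> (\<forall>w\<in>W. \<exists>f :: nat \<Rightarrow> int. range f \<subseteq> {-1, 1} \<and> factor_inf w (run_lengths_inf (paperfold_inf f)))"
  unfolding Let_def
proof (intro conjI allI impI ballI)
  fix f :: "int list" and w :: "nat list"
  assume "set f \<subseteq> {-1, 1}" "w \<noteq> [] \<and> palindrome w \<and> sublist w (run_lengths (paperfold f))"
  then show "w \<in> run_palindromes" using palindrome_factor_paperfold by meson
next
  fix f :: "nat \<Rightarrow> int" and w :: "nat list"
  assume f: "range f \<subseteq> {-1, 1}"
    and w: "w \<noteq> [] \<and> palindrome w \<and> factor_inf w (run_lengths_inf (paperfold_inf f))"
  then obtain g where "set g \<subseteq> {-1, 1}" "sublist w (run_lengths (paperfold g))"
    using factor_inf_finite by meson
  then show "w \<in> run_palindromes" using palindrome_factor_paperfold w by meson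
next
  fix w
  assume w: "w \<in> run_palindromes"
  then show "\<exists>f :: int list. set f \<subseteq> {-1, 1} \<and> sublist w (run_lengths (paperfold f))"
    by (rule run_palindromes_occur)
next
  fix w
  assume w: "w \<in> run_palindromes"
  then have "w \<noteq> []" by auto
  then show "\<exists>f :: nat \<Rightarrow> int. range f \<subseteq> {-1, 1} \<and> factor_inf w (run_lengths_inf (paperfold_inf f))"
    using run_palindromes_occur[OF w] sublist_paperfold_inf by meson
qed

end
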